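(* Fix a real number $a\ge0$, let $G=(V,E)$ be a finite simple graph with $V\ne\emptyset$ satisfying $\operatorname{mad}(G[N(v)])\le a$ for every $v\in V$, and let $\lambda\in\mathbb R_{>0}^V$. Write $$\ell_v=\log(1+\lambda_v),\qquad L=\max_{v\in V}\ell_v,\qquad C=e^{aL}.$$ Then $$\log Z_G(\lambda)\ge\max_{w\in\mathbb R_{>0}^V}\left\{\sum_{v\in V}w(v)\left(1+\log\frac{\ell_v}{w(v)}\right)-C\sum_{uv\in E}w(u)w(v)\right\}.$$ Consequently, $$\log Z_G(\lambda)\ge\sum_{v\in V}\frac{\mathcal A\bigl(W(Cd(v)\ell_v)\bigr)}{Cd(v)},$$ where the summand for $d(v)=0$ is interpreted as $\ell_v$.
   Context: All graphs are finite and simple; $\log$ is the natural logarithm. $N(v)$ is the set of neighbors of $v$ and $d(v)=|N(v)|$. The multivariate independence polynomial is $Z_G(\lambda)=\sum_{I\in\mathcal I(G)}\prod_{v\in I}\lambda_v$, where $\mathcal I(G)$ is the set of independent sets of $G$ including $\emptyset$. $\operatorname{mad}(H)=\max_{H'\subseteq H}2|E(H')|/|V(H')|$ (maximum over subgraphs $H'$ with at least one vertex), with $\operatorname{mad}(H)=0$ if $H$ has no vertices. $\mathcal A(x)=x^2/2+x$. $W$ is the principal nonnegative branch of the Lambert function: for $z\ge0$, $W(z)\ge0$ and $W(z)e^{W(z)}=z$. *)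

theory Defs
  imports "HOL-Analysis.Analysis" "HOL-Library.Ramsey"
begin

text \<open>
  A graph is given by its vertex set \<open>V\<close> and its edge set \<open>E\<close>, an edge being an unordered pair
  \<open>{u, v}\<close> of distinct vertices. Functions on \<open>V\<close> are functions on the ambient type, of which only
  the values on \<open>V\<close> matter.
\<close>

definition fin_simple_graph :: "'a set \<Rightarrow> 'a set set \<Rightarrow> bool" where
  "fin_simple_graph V E \<longleftrightarrow> finite V \<and> (\<forall>e\<in>E. e \<subseteq> V \<and> card e = 2)"

definition neighbors :: "'a set \<Rightarrow> 'a set set \<Rightarrow> 'a \<Rightarrow> 'a set" where
  "neighbors V E v = {u \<in> V. {u, v} \<in> E}"

definition vdegree :: "'a set \<Rightarrow> 'a set set \<Rightarrow> 'a \<Rightarrow> nat" where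
  "vdegree V E v = card (neighbors V E v)"

definition induced_edges :: "'a set set \<Rightarrow> 'a set \<Rightarrow> 'a set set" where
  "induced_edges E S = {e \<in> E. e \<subseteq> S}"

text \<open>The predicate \<open>indep I E\<close> of \<open>HOL-Library.Ramsey\<close> says that no two distinct vertices of \<open>I\<close>
  form an edge.\<close>

definition indep_sets :: "'a set \<Rightarrow> 'a set set \<Rightarrow> 'a set set" where
  "indep_sets V E = {I. I \<subseteq> V \<and> indep I E}"

definition indep_poly :: "'a set \<Rightarrow> 'a set set \<Rightarrow> ('a \<Rightarrow> real) \<Rightarrow> real" where
  "indep_poly V E lam = (\<Sum>I\<in>indep_sets V E. \<Prod>v\<in>I. lam v)"

definition subgraph :: "'a set \<Rightarrow> 'a set set \<Rightarrow> 'a set \<Rightarrow> 'a set set \<Rightarrow> bool" where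
  "subgraph V' E' V E \<longleftrightarrow> fin_simple_graph V' E' \<and> V' \<subseteq> V \<and> E' \<subseteq> E"

definition mad :: "'a set \<Rightarrow> 'a set set \<Rightarrow> real" where
  "mad V E =
     (if V = {} then 0
      else Max {2 * real (card E') / real (card V') | V' E'. subgraph V' E' V E \<and> V' \<noteq> {}})"

text \<open>\<open>Max\<close> is only meaningful on finite nonempty sets.\<close>

lemma mad_densities_finite:
  assumes "fin_simple_graph V E"
  shows "finite {2 * real (card E') / real (card V') | V' E'. subgraph V' E' V E \<and> V' \<noteq> {}}"
proof -
  have fV: "finite V" and "E \<subseteq> Pow V"
    using assms by (auto simp: fin_simple_graph_def)
  then have fE: "finite E"
    by (meson finite_Pow_iff finite_subset)
  have "{2 * real (card E') / real (card V') | V' E'. subgraph V' E' V E \<and> V' \<noteq> {}}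
      \<subseteq> (\<lambda>(V', E'). 2 * real (card E') / real (card V')) ` (Pow V \<times> Pow E)"
    by (auto simp: subgraph_def)
  then show ?thesis
    by (rule finite_subset) (use fV fE in auto)
qed

lemma mad_densities_nonempty:
  assumes "fin_simple_graph V E" and "V \<noteq> {}"
  shows "{2 * real (card E') / real (card V') | V' E'. subgraph V' E' V E \<and> V' \<noteq> {}} \<noteq> {}"
  using assms by (auto simp: subgraph_def)

text \<open>Principal nonnegative branch of the Lambert function; only used for \<open>z \<ge> 0\<close>.\<close>

definition lambert_W :: "real \<Rightarrow> real" where
  "lambert_W z = (THE w. 0 \<le> w \<and> w * exp w = z)"

lemma lambert_W_ex1:
  fixes z :: real
  assumes "0 \<le> z"
  shows "\<exists>!w. 0 \<le> w \<and> w * exp w = z"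
proof -
  have "\<exists>w\<ge>0. w \<le> z \<and> w * exp w = z"
  proof (rule IVT')
    show "z \<le> z * exp z"
      using assms mult_left_mono[of 1 "exp z" z] by simp
  qed (use assms in \<open>auto intro!: continuous_intros\<close>)
  then obtain w where w: "0 \<le> w" "w * exp w = z"
    by blast
  have less: "x * exp x < y * exp y" if "0 \<le> x" "x < y" for x y :: real
    using that by (intro mult_strict_mono) auto
  show ?thesis
  proof (rule ex1I[of _ w])
    fix y assume "0 \<le> y \<and> y * exp y = z"
    then show "y = w"
      using w less[of y w] less[of w y] by (cases y w rule: linorder_cases) auto
  qed (use w in simp)
qed

lemma lambert_W:
  assumes "0 \<le> z"
  shows "0 \<le> lambert_W z" and "lambert_W z * exp (lambert_W z) = z"
  using theI'[OF lambert_W_ex1[OF assms]] by (simp_all add: lambert_W_def)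

definition calA :: "real \<Rightarrow> real" where
  "calA x = x\<^sup>2 / 2 + x"

end

theory Submission
  imports Defs
begin

text \<open>
  Sample an independent set \<open>I\<close> with probability proportional to \<open>\<Prod>v\<in>I. lam v\<close>, and call the
  probability that \<open>I\<close> misses the neighbourhood of \<open>v\<close> the vacancy \<open>q v\<close>. The parametrisation
  \<open>lam v = exp (m v) - 1\<close> is natural because then the partial derivative of \<open>ln Z\<close> with respect to
  \<open>m v\<close> is exactly \<open>q v\<close> (\<open>ln_indep_poly_has_derivative\<close>). So lower bounds on the vacancies
  along a path of activities integrate to a lower bound on \<open>ln Z\<close>.

  The vacancies bound each other from below:
  \<open>q v \<ge> exp (- C * (\<Sum>u\<in>N v. m u * q u))\<close>, where \<open>C = exp (a * L)\<close>
  (\<open>vacancy_ge_exp_neighbor_vacancies\<close>). Given the part of \<open>I\<close> outside the neighbourhood \<open>N v\<close>,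
  the part inside is a random independent set of the graph \<open>H\<close> induced on the vertices of \<open>N v\<close>
  that are not yet blocked, so it is empty with probability \<open>1 / Z H\<close>, and Jensen's inequality
  bounds \<open>q v\<close> below by \<open>exp\<close> of the negated mean of \<open>ln (Z H)\<close>. The local sparsity enters only
  to compare \<open>ln (Z H)\<close> with the weighted vacancies inside \<open>H\<close>
  (\<open>ln_indep_poly_le_vacancy_sum\<close>): at most a factor \<open>C\<close> is lost, because the average degree in
  \<open>H\<close>, even weighted by \<open>m\<close>, is controlled by \<open>a\<close> (\<open>sum_min_neighbors_le\<close>).

  The objective attains its maximum at some \<open>w\<close>, where stationarity reads
  \<open>ell v = w v * exp (y v)\<close> with \<open>y v = C * (\<Sum>u\<in>N v. w u)\<close>. Instead of scaling \<open>ell\<close> linearly,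
  one follows the path \<open>m v t = t * w v * exp (t * y v)\<close>, for which \<open>t * w\<close> is a stationary point
  at every time \<open>t\<close>. Along it the derivative of \<open>ln Z\<close> is at least that of the value of the
  objective at \<open>t * w\<close> (\<open>ln_indep_poly_ge_fixed_point\<close>): use the tangent line of \<open>exp\<close> in the
  bound for the vacancies, average it with weights \<open>w\<close>, and exchange the two sums over adjacent
  vertices. Both sides vanish at \<open>t = 0\<close>, and \<open>t = 1\<close> is the claim. The explicit bound
  evaluates the objective at \<open>w v = W (C * d v * ell v) / (C * d v)\<close>, which is the stationary
  point after \<open>w u * w v\<close> has been replaced by \<open>((w u)\<^sup>2 + (w v)\<^sup>2) / 2\<close>.
\<close>

section \<open>Splitting the independence polynomial\<close>

lemma neighbors_subset: "neighbors S E v \<subseteq> S"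
  by (auto simp: neighbors_def)

lemma finite_neighbors [simp]: "finite S \<Longrightarrow> finite (neighbors S E v)"
  by (simp add: neighbors_def)

lemma finite_indep_sets [simp]: "finite S \<Longrightarrow> finite (indep_sets S E)"
  by (rule finite_subset[of _ "Pow S"]) (auto simp: indep_sets_def)

lemma empty_in_indep_sets [simp]: "{} \<in> indep_sets S E"
  by (simp add: indep_sets_def indep_def)

lemma indep_poly_ge_1:
  assumes "finite S" "\<And>v. v \<in> S \<Longrightarrow> lam v \<ge> 0"
  shows "indep_poly S E lam \<ge> 1"
proof -
  have "(\<Sum>I\<in>{{}}. prod lam I) \<le> (\<Sum>I\<in>indep_sets S E. prod lam I)"
    using assms by (intro sum_mono2) (auto simp: indep_sets_def intro!: prod_nonneg)
  then show ?thesis by (simp add: indep_poly_def)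
qed

lemma indep_poly_cong:
  assumes "\<And>v. v \<in> S \<Longrightarrow> lam v = mu v"
  shows "indep_poly S E lam = indep_poly S E mu"
  unfolding indep_poly_def using assms
  by (intro sum.cong prod.cong) (auto simp: indep_sets_def)

lemma indep_poly_le_prod:
  assumes "finite S" "\<And>v. v \<in> S \<Longrightarrow> lam v \<ge> 0"
  shows "indep_poly S E lam \<le> (\<Prod>v\<in>S. 1 + lam v)"
proof -
  have "indep_poly S E lam \<le> (\<Sum>I\<in>Pow S. prod lam I)"
    unfolding indep_poly_def using assms
    by (intro sum_mono2) (auto simp: indep_sets_def intro!: prod_nonneg)
  also have "\<dots> = (\<Prod>v\<in>S. lam v + 1)"
    using assms(1) by (subst prod_add) simp_all
  finally show ?thesis by (simp add: add.commute)
qed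

text \<open>The vertices of \<open>N\<close> that an independent set with part \<open>J\<close> outside \<open>N\<close> may still
  contain.\<close>

definition unblocked :: "'a set set \<Rightarrow> 'a set \<Rightarrow> 'a set \<Rightarrow> 'a set" where
  "unblocked E N J = {u \<in> N. \<forall>x\<in>J. {u, x} \<notin> E}"

lemma unblocked_subset: "unblocked E N J \<subseteq> N"
  by (auto simp: unblocked_def)

text \<open>This is the conditioning step behind everything below: once the part \<open>J\<close> of an independent set
  outside \<open>N\<close> is known, its part inside \<open>N\<close> ranges freely over the independent sets of the
  unblocked vertices.\<close>

lemma sum_indep_sets_split:
  assumes "finite S" "N \<subseteq> S"
  shows "(\<Sum>I\<in>indep_sets S E. g I)
       = (\<Sum>J\<in>indep_sets (S - N) E. \<Sum>K\<in>indep_sets (unblocked E N J) E. g (J \<union> K))"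
proof -
  have fin: "finite (unblocked E N J)" for J
    using assms by (meson finite_subset unblocked_subset)
  have "(\<Sum>J\<in>indep_sets (S - N) E. \<Sum>K\<in>indep_sets (unblocked E N J) E. g (J \<union> K))
     = (\<Sum>(J, K)\<in>Sigma (indep_sets (S - N) E) (\<lambda>J. indep_sets (unblocked E N J) E). g (J \<union> K))"
    using assms fin by (intro sum.Sigma) auto
  also have "\<dots> = (\<Sum>I\<in>indep_sets S E. g I)"
  proof (rule sum.reindex_bij_witness[of _ "\<lambda>I. (I - N, I \<inter> N)" "\<lambda>(J, K). J \<union> K"])
    fix p assume p: "p \<in> Sigma (indep_sets (S - N) E) (\<lambda>J. indep_sets (unblocked E N J) E)"
    then obtain J K where JK: "p = (J, K)" "J \<subseteq> S - N" "K \<subseteq> unblocked E N J" "indep J E" "indep K E"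
      by (auto simp: indep_sets_def)
    then have KN: "K \<subseteq> N"
      using unblocked_subset by fast
    have cross: "{u, x} \<notin> E" "{x, u} \<notin> E" if "u \<in> K" "x \<in> J" for u x
      using that JK by (auto simp: unblocked_def insert_commute)
    show "(case p of (J, K) \<Rightarrow> J \<union> K) \<in> indep_sets S E"
      using JK KN assms cross by (auto simp: indep_sets_def indep_def)
    show "(\<lambda>I. (I - N, I \<inter> N)) (case p of (J, K) \<Rightarrow> J \<union> K) = p"
      using JK KN by auto
    show "g (case p of (J, K) \<Rightarrow> J \<union> K) = (case p of (J, K) \<Rightarrow> g (J \<union> K))"
      by (simp add: JK)
  next
    fix I assume I: "I \<in> indep_sets S E"
    show "(case (I - N, I \<inter> N) of (J, K) \<Rightarrow> J \<union> K) = I"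
      by auto
    have "I - N \<in> indep_sets (S - N) E"
      using I by (auto simp: indep_sets_def indep_def)
    moreover have "{u, x} \<notin> E" if "u \<in> I \<inter> N" "x \<in> I - N" for u x
    proof -
      have "u \<in> I" "x \<in> I" "u \<noteq> x" "indep I E"
        using I that by (auto simp: indep_sets_def)
      then show ?thesis
        by (simp add: indep_def)
    qed
    then have "I \<inter> N \<in> indep_sets (unblocked E N (I - N)) E"
      using I by (auto simp: indep_sets_def indep_def unblocked_def)
    ultimately show "(I - N, I \<inter> N) \<in> Sigma (indep_sets (S - N) E) (\<lambda>J. indep_sets (unblocked E N J) E)"
      by simp
  qed
  finally show ?thesis by simp
qed

lemma prod_indep_split:
  assumes "finite S" "J \<in> indep_sets (S - N) E" "K \<in> indep_sets (unblocked E N J) E" "N \<subseteq> S"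
  shows "prod lam (J \<union> K) = prod lam J * prod lam K"
proof (rule prod.union_disjoint)
  have "J \<subseteq> S - N" "K \<subseteq> N"
    using assms(2,3) unblocked_subset[of E N J] by (auto simp: indep_sets_def)
  then show "finite J" "finite K" "J \<inter> K = {}"
    using assms(1,4) by (auto dest: finite_subset)
qed

lemma indep_poly_split:
  assumes "finite S" "N \<subseteq> S"
  shows "indep_poly S E lam
       = (\<Sum>J\<in>indep_sets (S - N) E. prod lam J * indep_poly (unblocked E N J) E lam)"
  unfolding indep_poly_def
  by (subst sum_indep_sets_split[OF assms])
     (auto simp: sum_distrib_left assms prod_indep_split[OF assms(1) _ _ assms(2)] intro!: sum.cong)

lemma indep_sets_diff: "indep_sets (S - N) E = {I \<in> indep_sets S E. I \<inter> N = {}}"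
  by (auto simp: indep_sets_def)

lemma indep_poly_diff:
  assumes "finite S"
  shows "indep_poly (S - N) E lam
       = (\<Sum>I\<in>indep_sets S E. if I \<inter> N = {} then prod lam I else 0)"
  unfolding indep_poly_def indep_sets_diff using assms by (intro sum.inter_filter) simp

text \<open>The same conditioning for the sets that avoid the neighbourhood of some \<open>u\<close> in \<open>N\<close>. If
  \<open>J\<close> contains a neighbour of \<open>u\<close>, that is, if it blocks \<open>u\<close>, it contributes nothing;
  otherwise only the neighbours of \<open>u\<close> among the unblocked vertices still have to be avoided.\<close>

lemma indep_poly_vacant_split:
  assumes "finite S" "N \<subseteq> S" "u \<in> N"
  shows "indep_poly (S - neighbors S E u) E lam
       = (\<Sum>J\<in>indep_sets (S - N) E. prod lam J *
            (if u \<in> unblocked E N J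
             then indep_poly (unblocked E N J - neighbors (unblocked E N J) E u) E lam else 0))"
proof -
  have fin: "finite (unblocked E N J)" for J
    using assms by (meson finite_subset unblocked_subset)
  have "(\<Sum>K\<in>indep_sets (unblocked E N J) E.
           if (J \<union> K) \<inter> neighbors S E u = {} then prod lam (J \<union> K) else 0)
      = prod lam J * (if u \<in> unblocked E N J
             then indep_poly (unblocked E N J - neighbors (unblocked E N J) E u) E lam else 0)"
    if J: "J \<in> indep_sets (S - N) E" for J
  proof (cases "u \<in> unblocked E N J")
    case True
    have "(J \<union> K) \<inter> neighbors S E u = K \<inter> neighbors (unblocked E N J) E u"
      if "K \<in> indep_sets (unblocked E N J) E" for K
    proof -
      have "J \<inter> neighbors S E u = {}"
        using True by (auto simp: neighbors_def unblocked_def insert_commute)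
      moreover have "K \<subseteq> unblocked E N J" "unblocked E N J \<subseteq> S"
        using that assms(2) unblocked_subset[of E N J] by (auto simp: indep_sets_def)
      then have "K \<inter> neighbors S E u = K \<inter> neighbors (unblocked E N J) E u"
        by (auto simp: neighbors_def)
      ultimately show ?thesis
        by blast
    qed
    then show ?thesis
      using True J fin
      by (auto simp: indep_poly_diff sum_distrib_left prod_indep_split[OF assms(1) _ _ assms(2)]
               intro!: sum.cong)
  next
    case False
    then have "(J \<union> K) \<inter> neighbors S E u \<noteq> {}" for K
      using J assms by (auto simp: neighbors_def indep_sets_def unblocked_def insert_commute)
    then show ?thesis using False by simp
  qed
  then show ?thesis
    by (simp add: indep_poly_diff assms sum_indep_sets_split[OF assms(1,2)])
qed

section \<open>Vacancies and the derivative of the free energy\<close>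

text \<open>The numerator sums the weights of the independent sets that avoid the neighbourhood of \<open>v\<close>, so
  this is the probability that a random independent set does so.\<close>

definition vacancy :: "'a set \<Rightarrow> 'a set set \<Rightarrow> ('a \<Rightarrow> real) \<Rightarrow> 'a \<Rightarrow> real" where
  "vacancy S E lam v = indep_poly (S - neighbors S E v) E lam / indep_poly S E lam"

lemma vacancy_pos:
  assumes "finite S" "\<And>v. v \<in> S \<Longrightarrow> lam v \<ge> 0"
  shows "vacancy S E lam v > 0"
proof -
  have "indep_poly S E lam \<ge> 1" "indep_poly (S - neighbors S E v) E lam \<ge> 1"
    using assms by (auto intro!: indep_poly_ge_1)
  then show ?thesis
    by (auto simp: vacancy_def intro!: divide_pos_pos)
qed

lemma ln_indep_poly_le:
  assumes "finite S" "\<And>v. v \<in> S \<Longrightarrow> lam v \<ge> 0"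
  shows "ln (indep_poly S E lam) \<le> (\<Sum>v\<in>S. ln (1 + lam v))"
proof -
  have pos: "1 + lam v > 0" if "v \<in> S" for v
    using assms(2)[OF that] by linarith
  have "ln (indep_poly S E lam) \<le> ln (\<Prod>v\<in>S. 1 + lam v)"
    using indep_poly_le_prod[of S lam E] indep_poly_ge_1[of S lam E] assms by (intro ln_mono) auto
  also have "\<dots> = (\<Sum>v\<in>S. ln (1 + lam v))"
    using assms(1) pos by (intro ln_prod) (metis less_irrefl)+
  finally show ?thesis .
qed

lemma exp_ln_indep_poly:
  assumes "finite S" "\<And>v. v \<in> S \<Longrightarrow> lam v \<ge> 0"
  shows "exp (ln (indep_poly S E lam)) = indep_poly S E lam"
  using indep_poly_ge_1[of S lam E] assms by (intro exp_ln) auto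

text \<open>Conditionally on the part outside the neighbourhood, the set misses the neighbourhood with
  probability one over an independence polynomial on at most the neighbours of \<open>v\<close>, and such a
  polynomial is at most the product of the factors \<open>1 + lam x\<close>.\<close>

lemma vacancy_ge_prod_neighbors:
  assumes "finite S" "\<And>v. v \<in> S \<Longrightarrow> lam v \<ge> 0"
  shows "exp (- (\<Sum>x\<in>neighbors S E v. ln (1 + lam x))) \<le> vacancy S E lam v"
proof -
  let ?N = "neighbors S E v" and ?U = "unblocked E (neighbors S E v)"
  let ?s = "\<Sum>x\<in>?N. ln (1 + lam x)"
  have N: "?N \<subseteq> S" "finite ?N"
    using assms by (simp_all add: neighbors_subset)
  have "indep_poly (?U J) E lam \<le> exp ?s" for J
  proof -
    have U: "?U J \<subseteq> ?N" "finite (?U J)"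
      using unblocked_subset[of E ?N J] N(2) by (auto dest: finite_subset)
    have "ln (indep_poly (?U J) E lam) \<le> (\<Sum>x\<in>?U J. ln (1 + lam x))"
      using U N assms by (intro ln_indep_poly_le) auto
    also have "\<dots> \<le> ?s"
      using U N assms by (intro sum_mono2) (auto intro!: ln_ge_zero)
    finally show ?thesis
      using exp_ln_indep_poly[of "?U J" lam E] U N assms by (metis exp_le_cancel_iff subsetD)
  qed
  moreover have "prod lam J \<ge> 0" if "J \<in> indep_sets (S - ?N) E" for J
    using that assms(2) by (intro prod_nonneg) (auto simp: indep_sets_def)
  ultimately have "indep_poly S E lam \<le> (\<Sum>J\<in>indep_sets (S - ?N) E. prod lam J * exp ?s)"
    unfolding indep_poly_split[OF assms(1) N(1)] by (intro sum_mono mult_left_mono) auto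
  also have "\<dots> = indep_poly (S - ?N) E lam * exp ?s"
    by (simp add: indep_poly_def sum_distrib_right)
  finally show ?thesis
    using indep_poly_ge_1[of S lam E] assms
    by (auto simp: vacancy_def exp_minus field_simps)
qed

lemma indep_poly_with_isolated_vertex:
  assumes "finite S" "v \<in> S" "v \<notin> neighbors S E v"
  shows "indep_poly (S - neighbors S E v) E lam
       = (1 + lam v) * indep_poly (S - neighbors S E v - {v}) E lam"
proof -
  let ?T = "S - neighbors S E v"
  have v: "v \<in> ?T" "finite ?T"
    using assms by auto
  have "unblocked E {v} J = {v}" if "J \<in> indep_sets (?T - {v}) E" for J
    using that assms by (auto simp: unblocked_def indep_sets_def neighbors_def insert_commute)
  moreover have "indep_sets {v} E = {{}, {v}}"
    by (auto simp: indep_sets_def indep_def)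
  then have "indep_poly {v} E lam = 1 + lam v"
    by (simp add: indep_poly_def)
  ultimately have "indep_poly ?T E lam = (\<Sum>J\<in>indep_sets (?T - {v}) E. prod lam J * (1 + lam v))"
    using v by (subst indep_poly_split[of _ "{v}"]) auto
  then show ?thesis
    by (simp add: indep_poly_def sum_distrib_left sum_distrib_right mult.commute)
qed

text \<open>Removing \<open>v\<close> is a bijection onto the independent sets that avoid \<open>v\<close> and its neighbours.\<close>

lemma sum_indep_sets_containing:
  assumes "finite S" "v \<in> S" "v \<notin> neighbors S E v"
  shows "(\<Sum>I\<in>{I \<in> indep_sets S E. v \<in> I}. prod lam (I - {v}))
       = indep_poly (S - neighbors S E v - {v}) E lam"
  unfolding indep_poly_def
proof (rule sum.reindex_bij_witness[of _ "insert v" "\<lambda>I. I - {v}"])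
  fix I assume "I \<in> {I \<in> indep_sets S E. v \<in> I}"
  then show "I - {v} \<in> indep_sets (S - neighbors S E v - {v}) E" "insert v (I - {v}) = I"
    using assms by (auto simp: indep_sets_def indep_def neighbors_def)
next
  fix J assume "J \<in> indep_sets (S - neighbors S E v - {v}) E"
  then show "insert v J - {v} = J" "insert v J \<in> {I \<in> indep_sets S E. v \<in> I}"
    using assms by (auto simp: indep_sets_def indep_def neighbors_def insert_commute)
qed simp

text \<open>Differentiating \<open>Z\<close> in the activity \<open>lam v = exp (m v) - 1\<close> leaves the sets that avoid
  \<open>v\<close> and its neighbours; the inner derivative \<open>exp (m v) = 1 + lam v\<close> supplies exactly the
  factor that puts \<open>v\<close> back as a free vertex. Hence no denominator appears, and the coefficient of
  \<open>m' v\<close> is the vacancy.\<close>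

lemma ln_indep_poly_has_derivative:
  fixes m :: "'a \<Rightarrow> real \<Rightarrow> real"
  assumes "finite S" and loopless: "\<And>v. v \<in> S \<Longrightarrow> v \<notin> neighbors S E v"
    and nonneg: "\<And>v. v \<in> S \<Longrightarrow> m v t \<ge> 0"
    and deriv: "\<And>v. v \<in> S \<Longrightarrow> (m v has_real_derivative m' v) (at t)"
  shows "((\<lambda>t. ln (indep_poly S E (\<lambda>v. exp (m v t) - 1)))
          has_real_derivative (\<Sum>v\<in>S. m' v * vacancy S E (\<lambda>v. exp (m v t) - 1) v)) (at t)"
proof -
  define lam where "lam v = exp (m v t) - 1" for v
  have Z: "indep_poly S E lam \<ge> 1"
    using assms by (auto simp: lam_def intro!: indep_poly_ge_1)
  have "((\<lambda>t. \<Sum>I\<in>indep_sets S E. \<Prod>v\<in>I. exp (m v t) - 1) has_real_derivative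
      (\<Sum>I\<in>indep_sets S E. \<Sum>v\<in>I. m' v * exp (m v t) * prod lam (I - {v}))) (at t)"
    unfolding lam_def
  proof (intro DERIV_sum has_field_derivative_prod)
    fix I v assume "I \<in> indep_sets S E" "v \<in> I"
    then have "v \<in> S"
      by (auto simp: indep_sets_def)
    then show "((\<lambda>t. exp (m v t) - 1) has_real_derivative m' v * exp (m v t)) (at t)"
      by (auto intro!: derivative_eq_intros deriv)
  qed
  also have "(\<Sum>I\<in>indep_sets S E. \<Sum>v\<in>I. m' v * exp (m v t) * prod lam (I - {v}))
      = (\<Sum>I\<in>indep_sets S E. \<Sum>v\<in>S. if v \<in> I then m' v * exp (m v t) * prod lam (I - {v}) else 0)"
    using assms(1) by (intro sum.cong refl sum.mono_neutral_cong_left) (auto simp: indep_sets_def)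
  also have "\<dots> = (\<Sum>v\<in>S. \<Sum>I\<in>indep_sets S E. if v \<in> I then m' v * exp (m v t) * prod lam (I - {v}) else 0)"
    by (rule sum.swap)
  also have "\<dots> = (\<Sum>v\<in>S. m' v * indep_poly (S - neighbors S E v) E lam)"
  proof (rule sum.cong[OF refl])
    fix v assume v: "v \<in> S"
    have "(\<Sum>I\<in>indep_sets S E. if v \<in> I then m' v * exp (m v t) * prod lam (I - {v}) else 0)
        = m' v * exp (m v t) * (\<Sum>I\<in>{I \<in> indep_sets S E. v \<in> I}. prod lam (I - {v}))"
      using assms(1) by (subst sum.inter_filter[symmetric]) (auto simp: sum_distrib_left)
    also have "\<dots> = m' v * ((1 + lam v) * indep_poly (S - neighbors S E v - {v}) E lam)"
      using sum_indep_sets_containing[OF assms(1) v loopless[OF v], of lam] by (simp add: lam_def)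
    also have "\<dots> = m' v * indep_poly (S - neighbors S E v) E lam"
      using indep_poly_with_isolated_vertex[OF assms(1) v loopless[OF v], of lam] by simp
    finally show "(\<Sum>I\<in>indep_sets S E. if v \<in> I then m' v * exp (m v t) * prod lam (I - {v}) else 0)
      = m' v * indep_poly (S - neighbors S E v) E lam" .
  qed
  finally have "((\<lambda>t. indep_poly S E (\<lambda>v. exp (m v t) - 1)) has_real_derivative
      (\<Sum>v\<in>S. m' v * indep_poly (S - neighbors S E v) E lam)) (at t)"
    by (simp add: indep_poly_def)
  moreover have "(ln has_real_derivative 1 / indep_poly S E lam) (at (indep_poly S E (\<lambda>v. exp (m v t) - 1)))"
    using Z by (auto intro!: derivative_eq_intros simp: lam_def[abs_def])
  ultimately have "((\<lambda>t. ln (indep_poly S E (\<lambda>v. exp (m v t) - 1))) has_real_derivative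
      1 / indep_poly S E lam * (\<Sum>v\<in>S. m' v * indep_poly (S - neighbors S E v) E lam)) (at t)"
    by (intro DERIV_chain2)
  then show ?thesis
    by (simp add: vacancy_def sum_distrib_left lam_def[abs_def])
qed

section \<open>Vacancies in locally sparse graphs\<close>

lemma exp_weighted_mean_le:
  fixes p x :: "'b \<Rightarrow> real"
  assumes "finite A" "\<And>i. i \<in> A \<Longrightarrow> p i \<ge> 0" "sum p A = 1"
  shows "exp (\<Sum>i\<in>A. p i * x i) \<le> (\<Sum>i\<in>A. p i * exp (x i))"
proof -
  have "A \<noteq> {}"
    using assms(3) by auto
  then show ?thesis
    using convex_on_sum[OF assms(1) _ exp_convex assms(3), of x] assms(2) by simp
qed

text \<open>Sparsity of all induced subgraphs (the left-hand side of the hypothesis is twice a number of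
  edges) passes to a vertex-weighted form. A weight function is a positive combination of indicators
  of its superlevel sets, and an edge lies in such a set as long as the level is below the minimum of
  its two weights. The induction peels off one level at a time: subtracting the least weight
  accounts for the whole graph once and makes a vertex of weight zero disappear.\<close>

lemma sum_min_neighbors_le:
  fixes f :: "'a \<Rightarrow> real"
  assumes "finite S"
    and "\<And>U. U \<subseteq> S \<Longrightarrow> (\<Sum>u\<in>U. real (card (neighbors U E u))) \<le> a * real (card U)"
    and "\<And>u. u \<in> S \<Longrightarrow> f u \<ge> 0"
  shows "(\<Sum>u\<in>S. \<Sum>x\<in>neighbors S E u. min (f u) (f x)) \<le> a * sum f S"
  using assms
proof (induction S arbitrary: f rule: finite_psubset_induct)
  case (psubset S)
  show ?case
  proof (cases "S = {}")
    case False
    obtain z where z: "z \<in> S" "\<And>u. u \<in> S \<Longrightarrow> f z \<le> f u"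
      using arg_min_if_finite[OF \<open>finite S\<close> False, of f] by (metis not_less)
    define g where "g u = f u - f z" for u
    define T where "T = S - {z}"
    have ST: "S = insert z T" "z \<notin> T" "T \<subset> S" "finite T"
      using z psubset.hyps by (auto simp: T_def)
    have g0: "g z = 0" "\<And>u. u \<in> S \<Longrightarrow> g u \<ge> 0"
      using z by (auto simp: g_def)
    have "(\<Sum>u\<in>S. \<Sum>x\<in>neighbors S E u. min (f u) (f x))
        = (\<Sum>u\<in>S. \<Sum>x\<in>neighbors S E u. f z + min (g u) (g x))"
      by (intro sum.cong refl) (simp add: g_def min_def)
    also have "\<dots> = f z * (\<Sum>u\<in>S. real (card (neighbors S E u)))
                   + (\<Sum>u\<in>S. \<Sum>x\<in>neighbors S E u. min (g u) (g x))"
      by (simp add: sum.distrib sum_distrib_left mult.commute)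
    also have "(\<Sum>u\<in>S. \<Sum>x\<in>neighbors S E u. min (g u) (g x))
        = (\<Sum>u\<in>T. \<Sum>x\<in>neighbors S E u. min (g u) (g x))"
    proof (rule sum.mono_neutral_right[OF psubset.hyps(1)])
      show "\<forall>u\<in>S - T. (\<Sum>x\<in>neighbors S E u. min (g u) (g x)) = 0"
        using ST g0 by (auto simp: neighbors_def intro!: sum.neutral)
    qed (use ST in auto)
    also have "\<dots> = (\<Sum>u\<in>T. \<Sum>x\<in>neighbors T E u. min (g u) (g x))"
    proof (rule sum.cong[OF refl], rule sum.mono_neutral_right)
      fix u assume "u \<in> T"
      then show "\<forall>x\<in>neighbors S E u - neighbors T E u. min (g u) (g x) = 0"
        using ST g0 by (auto simp: neighbors_def)
    qed (use ST psubset.hyps in \<open>auto simp: neighbors_def\<close>)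
    also have "\<dots> \<le> a * sum g T"
    proof (rule psubset.IH)
      show "T \<subset> S" by fact
      show "(\<Sum>u\<in>U. real (card (neighbors U E u))) \<le> a * real (card U)" if "U \<subseteq> T" for U
        using that ST by (intro psubset.prems) auto
      show "g u \<ge> 0" if "u \<in> T" for u
        using that g0 ST by auto
    qed
    also have "f z * (\<Sum>u\<in>S. real (card (neighbors S E u))) \<le> f z * (a * real (card S))"
      using psubset.prems z by (intro mult_left_mono) auto
    also have "f z * (a * real (card S)) + a * sum g T = a * sum f S"
    proof -
      have "sum g T = sum g S"
        using ST g0 by simp
      also have "\<dots> = sum f S - f z * real (card S)"
        by (simp add: g_def sum_subtractf mult.commute)
      finally have "sum f S = sum g T + f z * real (card S)"
        by simp
      then show ?thesis
        by (simp only: distrib_left mult_ac add.commute)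
    qed
    finally show ?thesis by simp
  qed simp
qed

text \<open>The left-hand side is at most the sum \<open>T\<close> of the \<open>l v = ln (1 + lam v)\<close>, and the vacancy of
  \<open>v\<close> is at least \<open>exp (- D v)\<close>, where \<open>D v\<close> sums \<open>l\<close> over the neighbours. By Jensen it remains
  to see that the mean of \<open>D\<close> with weights \<open>l v / T\<close> is at most \<open>a * L\<close>. Weighting by \<open>l\<close>
  rather than uniformly makes this mean symmetric in the two ends of an edge, so that
  \<open>l v * l x \<le> L * min (l v) (l x)\<close> reduces it to the weighted sparsity.\<close>

lemma ln_indep_poly_le_vacancy_sum:
  assumes "finite S" "a \<ge> 0"
    and sparse: "\<And>U. U \<subseteq> S \<Longrightarrow> (\<Sum>u\<in>U. real (card (neighbors U E u))) \<le> a * real (card U)"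
    and lam: "\<And>v. v \<in> S \<Longrightarrow> lam v \<ge> 0"
    and L: "\<And>v. v \<in> S \<Longrightarrow> ln (1 + lam v) \<le> L"
  shows "ln (indep_poly S E lam) \<le> exp (a * L) * (\<Sum>v\<in>S. ln (1 + lam v) * vacancy S E lam v)"
proof -
  define l where "l v = ln (1 + lam v)" for v
  define T where "T = sum l S"
  have l0: "l v \<ge> 0" if "v \<in> S" for v
    using lam[OF that] by (auto simp: l_def intro!: ln_ge_zero)
  have vac0: "vacancy S E lam v > 0" for v
    using assms by (intro vacancy_pos) auto
  have upper: "ln (indep_poly S E lam) \<le> T"
    using ln_indep_poly_le[of S lam E] assms by (simp add: T_def l_def)
  have T0: "T \<ge> 0"
    using l0 by (auto simp: T_def intro: sum_nonneg)
  show ?thesis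
  proof (cases "T = 0")
    case True
    have "0 \<le> exp (a * L) * (\<Sum>v\<in>S. l v * vacancy S E lam v)"
      using l0 vac0 by (intro mult_nonneg_nonneg sum_nonneg) (auto intro: less_imp_le)
    then show ?thesis
      using upper True by (simp add: l_def)
  next
    case False
    with T0 have T: "T > 0" by simp
    define D where "D v = (\<Sum>x\<in>neighbors S E v. l x)" for v
    have "(\<Sum>v\<in>S. l v * D v) = (\<Sum>v\<in>S. \<Sum>x\<in>neighbors S E v. l v * l x)"
      by (simp add: D_def sum_distrib_left)
    also have "\<dots> \<le> (\<Sum>v\<in>S. \<Sum>x\<in>neighbors S E v. L * min (l v) (l x))"
    proof (intro sum_mono)
      fix v x assume "v \<in> S" "x \<in> neighbors S E v"
      then have *: "0 \<le> l v" "0 \<le> l x" "l v \<le> L" "l x \<le> L"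
        using l0 L neighbors_subset[of S E v] by (auto simp: l_def)
      have "l v * l x \<le> L * l x" "l v * l x \<le> l v * L"
        using * by (intro mult_right_mono mult_left_mono; simp)+
      then show "l v * l x \<le> L * min (l v) (l x)"
        by (simp add: min_def mult.commute)
    qed
    also have "\<dots> = L * (\<Sum>v\<in>S. \<Sum>x\<in>neighbors S E v. min (l v) (l x))"
      by (simp add: sum_distrib_left)
    also have "\<dots> \<le> L * (a * T)"
    proof (rule mult_left_mono)
      show "(\<Sum>v\<in>S. \<Sum>x\<in>neighbors S E v. min (l v) (l x)) \<le> a * T"
        unfolding T_def by (rule sum_min_neighbors_le[OF assms(1) sparse l0])
      obtain v where "v \<in> S"
        using False by (fastforce simp: T_def)
      then show "L \<ge> 0"
        using l0[of v] L[of v] by (simp add: l_def)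
    qed
    finally have D: "(\<Sum>v\<in>S. l v * D v) \<le> L * (a * T)" .
    have "exp (- (a * L)) \<le> exp (\<Sum>v\<in>S. l v / T * - D v)"
    proof -
      have "(\<Sum>v\<in>S. l v / T * - D v) = - ((\<Sum>v\<in>S. l v * D v) / T)"
        by (simp add: sum_divide_distrib sum_negf)
      moreover have "(\<Sum>v\<in>S. l v * D v) / T \<le> a * L"
        using D T by (simp add: field_simps)
      ultimately show ?thesis by simp
    qed
    also have "\<dots> \<le> (\<Sum>v\<in>S. l v / T * exp (- D v))"
      using T l0 by (intro exp_weighted_mean_le assms)
        (auto simp: T_def sum_divide_distrib[symmetric])
    also have "\<dots> \<le> (\<Sum>v\<in>S. l v / T * vacancy S E lam v)"
      using T l0 vacancy_ge_prod_neighbors[of S lam E] assms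
      by (intro sum_mono mult_left_mono) (auto simp: D_def l_def)
    also have "\<dots> = (\<Sum>v\<in>S. l v * vacancy S E lam v) / T"
      by (simp add: sum_divide_distrib)
    finally have "T \<le> exp (a * L) * (\<Sum>v\<in>S. l v * vacancy S E lam v)"
      using T by (simp add: field_simps exp_minus)
    then show ?thesis
      using upper by (simp add: l_def)
  qed
qed

text \<open>Condition on the part \<open>J\<close> of the random set outside \<open>N = neighbors S E v\<close>, which has
  probability \<open>p J\<close>. Then \<open>vacancy S E lam v\<close> is the mean of \<open>1 / Z J\<close>, with \<open>Z J\<close> the
  independence polynomial on the unblocked vertices, and Jensen replaces it by the mean of
  \<open>ln (Z J)\<close>. The preceding lemma bounds the latter by vacancies within the unblocked graph, whose
  means are the vacancies of the neighbours of \<open>v\<close> in the whole graph.\<close>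

lemma vacancy_ge_exp_neighbor_vacancies:
  assumes "finite S" "a \<ge> 0"
    and sparse: "\<And>U. U \<subseteq> neighbors S E v \<Longrightarrow> (\<Sum>u\<in>U. real (card (neighbors U E u))) \<le> a * real (card U)"
    and lam: "\<And>v. v \<in> S \<Longrightarrow> lam v \<ge> 0"
    and L: "\<And>v. v \<in> S \<Longrightarrow> ln (1 + lam v) \<le> L"
  shows "exp (- (exp (a * L) * (\<Sum>u\<in>neighbors S E v. ln (1 + lam u) * vacancy S E lam u)))
       \<le> vacancy S E lam v"
proof -
  define N where "N = neighbors S E v"
  define U where "U = unblocked E N"
  define Z where "Z = indep_poly S E lam"
  define \<J> where "\<J> = indep_sets (S - N) E"
  define p where "p J = prod lam J * indep_poly (U J) E lam / Z" for J
  define l where "l v = ln (1 + lam v)" for v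
  have N: "N \<subseteq> S" "finite N"
    using assms by (simp_all add: N_def neighbors_subset)
  have U: "U J \<subseteq> N" "finite (U J)" "U J \<subseteq> S" for J
    using unblocked_subset[of E N J] N by (auto simp: U_def intro: finite_subset)
  have finJ: "finite \<J>"
    using assms by (simp add: \<J>_def)
  have Z: "Z \<ge> 1"
    using assms by (simp add: Z_def indep_poly_ge_1)
  have ZU: "indep_poly (U J) E lam \<ge> 1" for J
    using U(2,3)[of J] lam by (intro indep_poly_ge_1) auto
  have W: "prod lam J \<ge> 0" if "J \<in> \<J>" for J
    using that lam by (intro prod_nonneg) (auto simp: indep_sets_def \<J>_def)
  have p0: "p J \<ge> 0" if "J \<in> \<J>" for J
    using W[OF that] Z ZU[of J] by (simp add: p_def)
  have p1: "sum p \<J> = 1"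
    using indep_poly_split[OF assms(1) N(1), of E lam] Z
    by (simp add: p_def Z_def \<J>_def U_def sum_divide_distrib[symmetric])
  have vac_u: "vacancy S E lam u
      = (\<Sum>J\<in>\<J>. p J * (if u \<in> U J then vacancy (U J) E lam u else 0))" if "u \<in> N" for u
    unfolding vacancy_def indep_poly_vacant_split[OF assms(1) N(1) that] sum_divide_distrib
      \<J>_def[symmetric] U_def[symmetric] Z_def[symmetric]
  proof (rule sum.cong[OF refl])
    fix J
    show "prod lam J * (if u \<in> U J then indep_poly (U J - neighbors (U J) E u) E lam else 0) / Z
        = p J * (if u \<in> U J
                 then indep_poly (U J - neighbors (U J) E u) E lam / indep_poly (U J) E lam else 0)"
      using ZU[of J] by (simp add: p_def)
  qed
  have "(\<Sum>J\<in>\<J>. p J * ln (indep_poly (U J) E lam))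
      \<le> (\<Sum>J\<in>\<J>. p J * (exp (a * L) * (\<Sum>u\<in>U J. l u * vacancy (U J) E lam u)))"
  proof (intro sum_mono mult_left_mono p0)
    fix J assume "J \<in> \<J>"
    show "ln (indep_poly (U J) E lam) \<le> exp (a * L) * (\<Sum>u\<in>U J. l u * vacancy (U J) E lam u)"
      unfolding l_def using U[of J] assms
      by (intro ln_indep_poly_le_vacancy_sum) (auto simp: N_def)
  qed
  also have "\<dots> = exp (a * L) * (\<Sum>J\<in>\<J>. \<Sum>u\<in>N. l u * (p J * (if u \<in> U J then vacancy (U J) E lam u else 0)))"
  proof -
    have "(\<Sum>u\<in>U J. l u * vacancy (U J) E lam u)
        = (\<Sum>u\<in>N. l u * (if u \<in> U J then vacancy (U J) E lam u else 0))" for J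
      using U[of J] N by (intro sum.mono_neutral_cong_left) auto
    then show ?thesis
      by (simp add: sum_distrib_left mult_ac)
  qed
  also have "\<dots> = exp (a * L) * (\<Sum>u\<in>N. l u * vacancy S E lam u)"
    by (subst sum.swap) (simp add: vac_u sum_distrib_left)
  finally have "exp (- (exp (a * L) * (\<Sum>u\<in>N. l u * vacancy S E lam u)))
      \<le> exp (\<Sum>J\<in>\<J>. p J * - ln (indep_poly (U J) E lam))"
    by (simp add: sum_negf)
  also have "\<dots> \<le> (\<Sum>J\<in>\<J>. p J * exp (- ln (indep_poly (U J) E lam)))"
    by (intro exp_weighted_mean_le finJ p0 p1)
  also have "\<dots> = (\<Sum>J\<in>\<J>. prod lam J / Z)"
  proof (rule sum.cong[OF refl])
    fix J
    show "p J * exp (- ln (indep_poly (U J) E lam)) = prod lam J / Z"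
      using ZU[of J] by (simp add: p_def exp_minus)
  qed
  also have "\<dots> = vacancy S E lam v"
    by (simp add: vacancy_def Z_def N_def \<J>_def indep_poly_def sum_divide_distrib)
  finally show ?thesis
    by (simp add: N_def l_def)
qed

section \<open>Integration along a path of stationary points\<close>

text \<open>The adjacency matrix is symmetric.\<close>

lemma sum_neighbors_swap:
  fixes f g :: "'a \<Rightarrow> real"
  assumes "finite S"
  shows "(\<Sum>v\<in>S. f v * (\<Sum>u\<in>neighbors S E v. g u)) = (\<Sum>v\<in>S. g v * (\<Sum>u\<in>neighbors S E v. f u))"
proof -
  have "(\<Sum>v\<in>S. f v * (\<Sum>u\<in>neighbors S E v. g u)) = (\<Sum>v\<in>S. \<Sum>u\<in>S. if {u, v} \<in> E then f v * g u else 0)"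
    for f g :: "'a \<Rightarrow> real"
    using assms by (auto simp: neighbors_def sum_distrib_left sum.inter_filter intro!: sum.cong)
  note eq = this
  have "(\<Sum>v\<in>S. f v * (\<Sum>u\<in>neighbors S E v. g u)) = (\<Sum>u\<in>S. \<Sum>v\<in>S. if {u, v} \<in> E then f v * g u else 0)"
    unfolding eq by (rule sum.swap)
  also have "\<dots> = (\<Sum>v\<in>S. g v * (\<Sum>u\<in>neighbors S E v. f u))"
    unfolding eq
  proof (intro sum.cong refl)
    show "(if {u, v} \<in> E then f v * g u else 0) = (if {v, u} \<in> E then g u * f v else 0)" for u v
      by (simp add: insert_commute)
  qed
  finally show ?thesis .
qed

text \<open>At a stationary point \<open>w\<close>, the left-hand side is the value of the objective. It is the case
  \<open>t = 1\<close> of \<open>t * (\<Sum>v\<in>S. w v) + t\<^sup>2 / 2 * (\<Sum>v\<in>S. w v * y v)\<close>, the value at \<open>t * w\<close> for the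
  parameters \<open>m v t\<close>, and the difference \<open>\<Phi>\<close> to the free energy is nondecreasing in \<open>t\<close>. The
  path increases in \<open>t\<close>, so the bound \<open>L\<close>, and with it the constant \<open>C\<close>, serves for all of it.\<close>

lemma ln_indep_poly_ge_fixed_point:
  fixes w l :: "'a \<Rightarrow> real" and C :: real
  assumes fin: "finite S" and a: "a \<ge> 0"
    and loopless: "\<And>v. v \<in> S \<Longrightarrow> v \<notin> neighbors S E v"
    and sparse: "\<And>v U. v \<in> S \<Longrightarrow> U \<subseteq> neighbors S E v \<Longrightarrow>
                   (\<Sum>u\<in>U. real (card (neighbors U E u))) \<le> a * real (card U)"
    and L: "\<And>v. v \<in> S \<Longrightarrow> l v \<le> L" and C: "C = exp (a * L)"
    and w: "\<And>v. v \<in> S \<Longrightarrow> w v > 0"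
    and fp: "\<And>v. v \<in> S \<Longrightarrow> l v = w v * exp (C * (\<Sum>u\<in>neighbors S E v. w u))"
  shows "(\<Sum>v\<in>S. w v) + C / 2 * (\<Sum>v\<in>S. w v * (\<Sum>u\<in>neighbors S E v. w u))
       \<le> ln (indep_poly S E (\<lambda>v. exp (l v) - 1))"
proof -
  define y where "y v = C * (\<Sum>u\<in>neighbors S E v. w u)" for v
  define m where "m v t = t * w v * exp (t * y v)" for v t
  define m' where "m' v t = w v * exp (t * y v) * (1 + t * y v)" for v t
  define \<Phi> where "\<Phi> t = ln (indep_poly S E (\<lambda>v. exp (m v t) - 1))
      - (t * (\<Sum>v\<in>S. w v) + t\<^sup>2 / 2 * (\<Sum>v\<in>S. w v * y v))" for t
  have y0: "y v \<ge> 0" for v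
    unfolding y_def C using w neighbors_subset[of S E v]
    by (intro mult_nonneg_nonneg sum_nonneg) (auto intro: less_imp_le)
  have "\<Phi> 0 \<le> \<Phi> 1"
  proof (rule DERIV_nonneg_imp_nondecreasing[of 0 1 \<Phi>])
    fix t :: real assume t: "0 \<le> t" "t \<le> 1"
    define lam where "lam v = exp (m v t) - 1" for v
    define q where "q v = vacancy S E lam v" for v
    \<comment> \<open>Chosen so that \<open>m v t * q v = t * w v * z v\<close> and \<open>m' v t * q v = w v * z v * (1 + t * y v)\<close>;
      no division by \<open>t\<close> is needed, which lets the argument include \<open>t = 0\<close>.\<close>
    define z where "z v = exp (t * y v) * q v" for v
    have m0: "m v t \<ge> 0" if "v \<in> S" for v
      using t w[OF that] by (simp add: m_def)
    have mL: "m v t \<le> L" if "v \<in> S" for v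
    proof -
      have "m v t \<le> 1 * w v * exp (1 * y v)"
        unfolding m_def using t w[OF that] y0[of v]
        by (intro mult_mono mult_nonneg_nonneg iffD2[OF exp_le_cancel_iff]) auto
      also have "\<dots> \<le> L"
        using L[OF that] fp[OF that] by (simp add: y_def)
      finally show ?thesis .
    qed
    have lam: "lam v \<ge> 0" "ln (1 + lam v) = m v t" if "v \<in> S" for v
      using m0[OF that] by (simp_all add: lam_def)
    have q0: "q v > 0" for v
      unfolding q_def by (rule vacancy_pos[OF fin lam(1)])
    have z_ge: "z v \<ge> 1 + t * y v - C * (\<Sum>u\<in>neighbors S E v. t * w u * z u)" if v: "v \<in> S" for v
    proof -
      have "exp (- (C * (\<Sum>u\<in>neighbors S E v. ln (1 + lam u) * q u))) \<le> q v"
        unfolding q_def C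
        by (rule vacancy_ge_exp_neighbor_vacancies[OF fin a sparse[OF v]]) (use lam mL in auto)
      also have "(\<Sum>u\<in>neighbors S E v. ln (1 + lam u) * q u) = (\<Sum>u\<in>neighbors S E v. t * w u * z u)"
        using neighbors_subset[of S E v] by (intro sum.cong) (auto simp: lam m_def z_def)
      finally have "exp (t * y v) * exp (- (C * (\<Sum>u\<in>neighbors S E v. t * w u * z u))) \<le> z v"
        by (simp add: z_def)
      then have "exp (t * y v - C * (\<Sum>u\<in>neighbors S E v. t * w u * z u)) \<le> z v"
        by (simp add: exp_diff exp_minus field_simps)
      then show ?thesis
        using exp_ge_add_one_self[of "t * y v - C * (\<Sum>u\<in>neighbors S E v. t * w u * z u)"] by linarith
    qed
    \<comment> \<open>After exchanging the sums, the interaction on the left becomes \<open>t * (\<Sum>v\<in>S. w v * z v * y v)\<close>;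
      moved to the right, it completes the derivative of the free energy.\<close>
    have "(\<Sum>v\<in>S. w v * (1 + t * y v - C * (\<Sum>u\<in>neighbors S E v. t * w u * z u))) \<le> (\<Sum>v\<in>S. w v * z v)"
      using z_ge w by (intro sum_mono mult_left_mono) (auto intro: less_imp_le)
    also have "(\<Sum>v\<in>S. w v * (1 + t * y v - C * (\<Sum>u\<in>neighbors S E v. t * w u * z u)))
        = (\<Sum>v\<in>S. w v) + t * (\<Sum>v\<in>S. w v * y v)
          - C * (\<Sum>v\<in>S. w v * (\<Sum>u\<in>neighbors S E v. t * w u * z u))"
      by (simp add: algebra_simps sum.distrib sum_subtractf sum_distrib_left)
    also have "C * (\<Sum>v\<in>S. w v * (\<Sum>u\<in>neighbors S E v. t * w u * z u)) = t * (\<Sum>v\<in>S. w v * z v * y v)"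
      by (subst sum_neighbors_swap[OF fin]) (simp add: y_def sum_distrib_left mult_ac)
    finally have key: "(\<Sum>v\<in>S. w v) + t * (\<Sum>v\<in>S. w v * y v) \<le> (\<Sum>v\<in>S. m' v t * q v)"
      by (simp add: m'_def z_def algebra_simps sum.distrib sum_distrib_left)
    have "((\<lambda>t. ln (indep_poly S E (\<lambda>v. exp (m v t) - 1))) has_real_derivative
            (\<Sum>v\<in>S. m' v t * vacancy S E (\<lambda>v. exp (m v t) - 1) v)) (at t)"
    proof (rule ln_indep_poly_has_derivative)
      show "(m v has_real_derivative m' v t) (at t)" for v
        unfolding m_def[abs_def] m'_def by (auto intro!: derivative_eq_intros simp: algebra_simps)
    qed (use fin loopless m0 in auto)
    note ln_deriv = this
    have "((\<lambda>t. t * (\<Sum>v\<in>S. w v) + t\<^sup>2 / 2 * (\<Sum>v\<in>S. w v * y v)) has_real_derivative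
            (\<Sum>v\<in>S. w v) + t * (\<Sum>v\<in>S. w v * y v)) (at t)"
      by (auto intro!: derivative_eq_intros)
    from DERIV_diff[OF ln_deriv this] have "(\<Phi> has_real_derivative
        (\<Sum>v\<in>S. m' v t * q v) - ((\<Sum>v\<in>S. w v) + t * (\<Sum>v\<in>S. w v * y v))) (at t)"
      by (simp add: \<Phi>_def[abs_def] q_def lam_def[abs_def])
    then show "\<exists>d. (\<Phi> has_real_derivative d) (at t) \<and> d \<ge> 0"
      using key by (intro exI conjI) auto
  qed simp
  moreover have "\<Phi> 0 = 0"
  proof -
    have "prod (\<lambda>_. 0) I = (if I = {} then 1 else 0::real)" if "I \<in> indep_sets S E" for I
      using that fin by (auto simp: indep_sets_def prod_zero_iff dest: finite_subset)
    then have "indep_poly S E (\<lambda>v. 0) = 1"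
      using fin by (simp add: indep_poly_def sum.delta)
    then show ?thesis
      by (simp add: \<Phi>_def m_def)
  qed
  moreover have "indep_poly S E (\<lambda>v. exp (m v 1) - 1) = indep_poly S E (\<lambda>v. exp (l v) - 1)"
    by (rule indep_poly_cong) (simp add: m_def fp y_def)
  moreover have "(\<Sum>v\<in>S. w v * y v) = C * (\<Sum>v\<in>S. w v * (\<Sum>u\<in>neighbors S E v. w u))"
    by (simp add: y_def sum_distrib_left mult_ac)
  ultimately show ?thesis
    by (simp add: \<Phi>_def)
qed

section \<open>Sums over edges and neighbourhoods\<close>

lemma sum_neighbors_eq_sum_edges:
  assumes "fin_simple_graph V E" "v \<in> V"
  shows "(\<Sum>u\<in>neighbors V E v. g {u, v}) = (\<Sum>e\<in>{e \<in> E. v \<in> e}. g e)"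
proof (rule sum.reindex_bij_betw)
  have "inj_on (\<lambda>u. {u, v}) (neighbors V E v)"
    by (auto simp: inj_on_def doubleton_eq_iff)
  moreover have "(\<lambda>u. {u, v}) ` neighbors V E v = {e \<in> E. v \<in> e}"
  proof (intro equalityI subsetI)
    fix e assume e: "e \<in> {e \<in> E. v \<in> e}"
    then have "card e = 2" "e \<subseteq> V"
      using assms by (auto simp: fin_simple_graph_def)
    then obtain u where "e = {u, v}"
      using e by (auto simp: card_2_iff)
    then show "e \<in> (\<lambda>u. {u, v}) ` neighbors V E v"
      using e \<open>e \<subseteq> V\<close> by (auto simp: neighbors_def)
  qed (auto simp: neighbors_def)
  ultimately show "bij_betw (\<lambda>u. {u, v}) (neighbors V E v) {e \<in> E. v \<in> e}"
    by (simp add: bij_betw_def)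
qed

lemma finite_edges: "fin_simple_graph V E \<Longrightarrow> finite E"
  by (rule finite_subset[of _ "Pow V"]) (auto simp: fin_simple_graph_def)

lemma not_self_neighbor: "fin_simple_graph V E \<Longrightarrow> v \<notin> neighbors V E v"
  by (auto simp: fin_simple_graph_def neighbors_def)

lemma sum_neighbors_handshake:
  fixes g :: "'a set \<Rightarrow> real"
  assumes "fin_simple_graph V E"
  shows "(\<Sum>v\<in>V. \<Sum>u\<in>neighbors V E v. g {u, v}) = 2 * (\<Sum>e\<in>E. g e)"
proof -
  have fin: "finite V" "finite E"
    using assms finite_edges by (auto simp: fin_simple_graph_def)
  have "(\<Sum>v\<in>V. \<Sum>u\<in>neighbors V E v. g {u, v}) = (\<Sum>v\<in>V. \<Sum>e\<in>E. if v \<in> e then g e else 0)"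
    using fin by (intro sum.cong refl) (simp add: sum_neighbors_eq_sum_edges[OF assms] sum.inter_filter)
  also have "\<dots> = (\<Sum>e\<in>E. \<Sum>v\<in>V. if v \<in> e then g e else 0)"
    by (rule sum.swap)
  also have "\<dots> = (\<Sum>e\<in>E. 2 * g e)"
  proof (rule sum.cong[OF refl])
    fix e assume "e \<in> E"
    then have e: "e \<subseteq> V" "card e = 2"
      using assms by (auto simp: fin_simple_graph_def)
    have "(\<Sum>v\<in>V. if v \<in> e then g e else 0) = (\<Sum>v\<in>e. g e)"
      using e fin by (intro sum.mono_neutral_cong_right) auto
    then show "(\<Sum>v\<in>V. if v \<in> e then g e else 0) = 2 * g e"
      using e by simp
  qed
  finally show ?thesis
    by (simp add: sum_distrib_left)
qed

lemma sum_edge_prod_eq: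
  fixes w :: "'a \<Rightarrow> real"
  assumes "fin_simple_graph V E"
  shows "(\<Sum>e\<in>E. prod w e) = (\<Sum>v\<in>V. w v * (\<Sum>u\<in>neighbors V E v. w u)) / 2"
proof -
  have "(\<Sum>v\<in>V. w v * (\<Sum>u\<in>neighbors V E v. w u)) = (\<Sum>v\<in>V. \<Sum>u\<in>neighbors V E v. prod w {u, v})"
    unfolding sum_distrib_left
  proof (intro sum.cong refl)
    fix v u assume "u \<in> neighbors V E v"
    then have "u \<noteq> v"
      using not_self_neighbor[OF assms] by blast
    then show "w v * w u = prod w {u, v}"
      by simp
  qed
  then show ?thesis
    using sum_neighbors_handshake[OF assms, of "prod w"] by simp
qed

text \<open>The edge sum is affine in each coordinate, so the objective can be maximised exactly in one
  coordinate while the others stay fixed.\<close>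

lemma sum_edge_prod_fun_upd:
  fixes w :: "'a \<Rightarrow> real"
  assumes "fin_simple_graph V E" "v \<in> V"
  shows "(\<Sum>e\<in>E. prod (w(v := x)) e)
       = (\<Sum>e\<in>{e \<in> E. v \<notin> e}. prod w e) + x * (\<Sum>u\<in>neighbors V E v. w u)"
proof -
  have fin: "finite E"
    using assms finite_edges by blast
  have "(\<Sum>e\<in>E. prod (w(v := x)) e)
      = (\<Sum>e\<in>{e \<in> E. v \<notin> e}. prod (w(v := x)) e) + (\<Sum>e\<in>{e \<in> E. v \<in> e}. prod (w(v := x)) e)"
    using fin by (subst sum.union_disjoint[symmetric]) (auto intro: sum.cong)
  also have "(\<Sum>e\<in>{e \<in> E. v \<in> e}. prod (w(v := x)) e) = (\<Sum>u\<in>neighbors V E v. prod (w(v := x)) {u, v})"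
    by (rule sum_neighbors_eq_sum_edges[OF assms, symmetric])
  also have "\<dots> = (\<Sum>u\<in>neighbors V E v. x * w u)"
  proof (rule sum.cong[OF refl])
    fix u assume "u \<in> neighbors V E v"
    then have "u \<noteq> v"
      using not_self_neighbor[OF assms(1)] by blast
    then show "prod (w(v := x)) {u, v} = x * w u"
      by simp
  qed
  also have "(\<Sum>e\<in>{e \<in> E. v \<notin> e}. prod (w(v := x)) e) = (\<Sum>e\<in>{e \<in> E. v \<notin> e}. prod w e)"
    by (intro sum.cong prod.cong refl) auto
  finally show ?thesis
    by (simp add: sum_distrib_left)
qed

text \<open>The induced subgraph on \<open>U\<close> is one of the subgraphs over which \<open>mad\<close> maximises, and twice its
  number of edges is its degree sum.\<close>

lemma mad_le_imp_sparse:
  assumes graph: "fin_simple_graph V E" and "N \<subseteq> V" "mad N (induced_edges E N) \<le> a" "U \<subseteq> N"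
  shows "(\<Sum>u\<in>U. real (card (neighbors U E u))) \<le> a * real (card U)"
proof (cases "U = {}")
  case False
  let ?EU = "induced_edges E U" and ?EN = "induced_edges E N"
  have fin: "finite V"
    using graph by (simp add: fin_simple_graph_def)
  then have finU: "finite U" "finite N"
    using assms by (auto intro: finite_subset)
  have gU: "fin_simple_graph U ?EU" and gN: "fin_simple_graph N ?EN"
    using graph finU by (auto simp: fin_simple_graph_def induced_edges_def)
  have "subgraph U ?EU N ?EN"
    using gU assms by (auto simp: subgraph_def induced_edges_def)
  then have "2 * real (card ?EU) / real (card U) \<le> mad N ?EN"
    using False assms unfolding mad_def
    by (auto intro!: Max_ge mad_densities_finite[OF gN])
  then have "2 * real (card ?EU) / real (card U) \<le> a"
    using assms by linarith
  then have "2 * real (card ?EU) \<le> a * real (card U)"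
    using False finU by (simp add: divide_le_eq card_gt_0_iff)
  moreover have "(\<Sum>u\<in>U. real (card (neighbors U E u))) = (\<Sum>u\<in>U. \<Sum>x\<in>neighbors U ?EU u. 1)"
    by (intro sum.cong refl) (auto simp: neighbors_def induced_edges_def intro!: arg_cong[where f = card])
  moreover have "\<dots> = 2 * real (card ?EU)"
    using sum_neighbors_handshake[OF gU, of "\<lambda>_. 1"] by simp
  ultimately show ?thesis
    by simp
qed simp

section \<open>Maximisation of the objective\<close>

text \<open>The function of \<open>x\<close> on the left is the concave one-vertex part of the objective with parameter
  \<open>s\<close>; its maximum is at \<open>x = s\<close>, and only there by the next lemma.\<close>

lemma mult_one_plus_ln_le:
  fixes x s :: real
  assumes "x > 0" "s > 0"
  shows "x * (1 + ln (s / x)) \<le> s"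
proof -
  have "x * (1 + ln (s / x)) \<le> x * (s / x)"
    using assms ln_le_minus_one[of "s / x"] by (intro mult_left_mono) auto
  then show ?thesis
    using assms by simp
qed

lemma mult_one_plus_ln_eq_imp:
  fixes x s :: real
  assumes "x > 0" "s > 0" "s \<le> x * (1 + ln (s / x))"
  shows "x = s"
proof -
  have "s / x \<le> 1 + ln (s / x)"
    using assms by (simp add: field_simps)
  then have "ln (s / x) = s / x - 1"
    using assms ln_le_minus_one[of "s / x"] by simp
  then have "s / x = 1"
    using assms by (intro ln_eq_minus_one) auto
  then show ?thesis
    using assms by simp
qed

lemma is_arg_max_ge:
  fixes f :: "'b \<Rightarrow> real"
  assumes "is_arg_max f P w" "P x"
  shows "f x \<le> f w"
  using assms by (meson is_arg_max_def linorder_not_less)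

text \<open>The objective of the maximisation; its first part is an entropy, its second an interaction
  energy.\<close>

definition entropy_energy :: "'a set \<Rightarrow> 'a set set \<Rightarrow> real \<Rightarrow> ('a \<Rightarrow> real) \<Rightarrow> ('a \<Rightarrow> real) \<Rightarrow> real" where
  "entropy_energy V E C l w = (\<Sum>v\<in>V. w v * (1 + ln (l v / w v))) - C * (\<Sum>e\<in>E. \<Prod>v\<in>e. w v)"

text \<open>As a function of the coordinate \<open>x\<close> at \<open>v\<close> alone, the objective is a constant plus
  \<open>x * (1 + ln (s / x))\<close>, the linear interaction with the neighbours being absorbed into \<open>s\<close>. The
  only maximiser of this is \<open>x = s\<close>, which is the stationarity equation.\<close>

lemma is_arg_max_entropy_energy_fixed_point:
  assumes "fin_simple_graph V E" and l: "\<And>v. v \<in> V \<Longrightarrow> l v > 0"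
    and max: "is_arg_max (entropy_energy V E C l) (\<lambda>w. \<forall>v\<in>V. w v > 0) w"
    and v: "v \<in> V"
  shows "l v = w v * exp (C * (\<Sum>u\<in>neighbors V E v. w u))"
proof -
  have fin: "finite V"
    using assms by (simp add: fin_simple_graph_def)
  have w: "w u > 0" if "u \<in> V" for u
    using max that by (simp add: is_arg_max_def)
  define Y where "Y = C * (\<Sum>u\<in>neighbors V E v. w u)"
  define s where "s = l v * exp (- Y)"
  define R where "R = (\<Sum>u\<in>V - {v}. w u * (1 + ln (l u / w u))) - C * (\<Sum>e\<in>{e \<in> E. v \<notin> e}. prod w e)"
  have s: "s > 0"
    using l[OF v] by (simp add: s_def)
  have F: "entropy_energy V E C l (w(v := x)) = R + x * (1 + ln (s / x))" if "x > 0" for x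
  proof -
    have ln_s: "ln (s / x) = ln (l v / x) - Y"
      using l[OF v] that by (simp add: s_def ln_div ln_mult)
    have "x * (1 + ln (l v / x)) - C * (x * (\<Sum>u\<in>neighbors V E v. w u)) = x * (1 + ln (s / x))"
      unfolding ln_s by (simp add: Y_def algebra_simps)
    moreover have "(\<Sum>u\<in>V. (w(v := x)) u * (1 + ln (l u / (w(v := x)) u)))
       = x * (1 + ln (l v / x)) + (\<Sum>u\<in>V - {v}. w u * (1 + ln (l u / w u)))"
      by (subst sum.remove[OF fin v]) simp
    ultimately show ?thesis
      unfolding entropy_energy_def sum_edge_prod_fun_upd[OF assms(1) v] R_def
      by (simp add: distrib_left)
  qed
  have "entropy_energy V E C l (w(v := s)) \<le> entropy_energy V E C l (w(v := w v))"
  proof -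
    have "\<forall>u\<in>V. (w(v := s)) u > 0"
      using w s by simp
    then show ?thesis
      using is_arg_max_ge[OF max] by simp
  qed
  then have "s \<le> w v * (1 + ln (s / w v))"
    using F[OF s] F[OF w[OF v]] s by simp
  then have "w v = s"
    using mult_one_plus_ln_eq_imp[OF w[OF v] s] by simp
  then show ?thesis
    by (simp add: s_def Y_def exp_minus)
qed

lemma compact_box_functions:
  fixes lo hi :: "'a \<Rightarrow> real"
  shows "compact {w. \<forall>v. lo v \<le> w v \<and> w v \<le> hi v}"
proof -
  have "compactin (product_topology (\<lambda>_. euclidean) UNIV) (PiE UNIV (\<lambda>v. {lo v..hi v}))"
    by (simp add: compactin_PiE)
  moreover have "PiE UNIV (\<lambda>v. {lo v..hi v}) = {w. \<forall>v. lo v \<le> w v \<and> w v \<le> hi v}"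
    by auto
  ultimately show ?thesis
    by (simp add: euclidean_product_topology)
qed

text \<open>Lowering a coordinate to \<open>l v\<close> moves its entropy term to the maximum and shrinks the
  interaction.\<close>

lemma entropy_energy_le_min:
  assumes "C \<ge> 0" and l: "\<And>v. v \<in> V \<Longrightarrow> l v > 0"
    and w: "\<And>v. v \<in> V \<Longrightarrow> w v > 0" and graph: "fin_simple_graph V E"
  shows "entropy_energy V E C l w \<le> entropy_energy V E C l (\<lambda>v. min (l v) (w v))"
proof -
  have "w v * (1 + ln (l v / w v)) \<le> min (l v) (w v) * (1 + ln (l v / min (l v) (w v)))"
    if "v \<in> V" for v
    using mult_one_plus_ln_le[OF w[OF that] l[OF that]] l[OF that] by (auto simp: min_def)
  moreover have "(\<Prod>v\<in>e. min (l v) (w v)) \<le> (\<Prod>v\<in>e. w v)" if "e \<in> E" for e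
  proof (rule prod_mono)
    fix v assume "v \<in> e"
    then have "v \<in> V"
      using graph that by (auto simp: fin_simple_graph_def)
    then show "0 \<le> min (l v) (w v) \<and> min (l v) (w v) \<le> w v"
      using l[of v] w[of v] by auto
  qed
  ultimately show ?thesis
    unfolding entropy_energy_def using \<open>C \<ge> 0\<close>
    by (intro diff_mono sum_mono mult_left_mono) auto
qed

text \<open>Below \<open>l\<close>, raising a coordinate costs interaction at a rate of at most
  \<open>Y v = C * (\<Sum>u\<in>neighbors V E v. l u)\<close>, while the entropy term has slope \<open>ln (l v / x)\<close>, which is
  at least \<open>Y v\<close> for \<open>x\<close> up to \<open>d v = l v * exp (- Y v)\<close>. So coordinates below \<open>d v\<close> may be
  raised to \<open>d v\<close>.\<close>

lemma entropy_energy_le_max: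
  assumes C: "C \<ge> 0" and graph: "fin_simple_graph V E" and l: "\<And>v. v \<in> V \<Longrightarrow> l v > 0"
    and w: "\<And>v. v \<in> V \<Longrightarrow> 0 < w v \<and> w v \<le> l v"
    and d: "\<And>v. v \<in> V \<Longrightarrow> d v = l v * exp (- (C * (\<Sum>u\<in>neighbors V E v. l u)))"
  shows "entropy_energy V E C l w \<le> entropy_energy V E C l (\<lambda>v. max (d v) (w v))"
proof -
  define Y where "Y v = C * (\<Sum>u\<in>neighbors V E v. l u)" for v
  define w' where "w' v = max (d v) (w v)" for v
  have fin: "finite V"
    using graph by (simp add: fin_simple_graph_def)
  have Y0: "Y v \<ge> 0" for v
    unfolding Y_def using C l neighbors_subset[of V E v]
    by (intro mult_nonneg_nonneg sum_nonneg) (auto intro: less_imp_le)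
  have dl: "0 < d v" "d v \<le> l v" "ln (l v / d v) = Y v" if "v \<in> V" for v
  proof -
    have dv: "d v = l v * exp (- Y v)"
      using d[OF that] by (simp add: Y_def)
    then show "0 < d v" "d v \<le> l v"
      using l[OF that] Y0[of v] by simp_all
    have "l v / d v = exp (Y v)"
      using l[OF that] by (simp add: dv exp_minus field_simps)
    then show "ln (l v / d v) = Y v"
      by simp
  qed
  have gain: "(w' v - w v) * Y v \<le> w' v * (1 + ln (l v / w' v)) - w v * (1 + ln (l v / w v))"
    if v: "v \<in> V" for v
  proof (cases "w v < d v")
    case True
    have "ln (d v / w v) = ln (l v / w v) - Y v"
      using dl(3)[OF v] dl[OF v] w[OF v] l[OF v] by (simp add: ln_div)
    then have "w v * (1 + (ln (l v / w v) - Y v)) \<le> d v"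
      using mult_one_plus_ln_le[of "w v" "d v"] w[OF v] dl[OF v] by simp
    then show ?thesis
      using True dl(3)[OF v] by (simp add: w'_def algebra_simps)
  qed (simp add: w'_def)
  have w': "w v \<le> w' v" "w' v \<le> l v" if "v \<in> V" for v
    using w[OF that] dl[OF that] by (auto simp: w'_def)
  have "(\<Sum>v\<in>V. w' v * (\<Sum>u\<in>neighbors V E v. w' u)) - (\<Sum>v\<in>V. w v * (\<Sum>u\<in>neighbors V E v. w u))
      = (\<Sum>v\<in>V. w' v * (\<Sum>u\<in>neighbors V E v. w' u - w u)) + (\<Sum>v\<in>V. (w' v - w v) * (\<Sum>u\<in>neighbors V E v. w u))"
    by (simp add: algebra_simps sum.distrib sum_subtractf)
  also have "(\<Sum>v\<in>V. w' v * (\<Sum>u\<in>neighbors V E v. w' u - w u))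
      = (\<Sum>v\<in>V. (w' v - w v) * (\<Sum>u\<in>neighbors V E v. w' u))"
    by (rule sum_neighbors_swap[OF fin])
  also have "\<dots> \<le> (\<Sum>v\<in>V. (w' v - w v) * (\<Sum>u\<in>neighbors V E v. l u))"
    using w' neighbors_subset[of V E] by (intro sum_mono mult_left_mono) auto
  also have "(\<Sum>v\<in>V. (w' v - w v) * (\<Sum>u\<in>neighbors V E v. w u))
      \<le> (\<Sum>v\<in>V. (w' v - w v) * (\<Sum>u\<in>neighbors V E v. l u))"
    using w w' neighbors_subset[of V E] by (intro sum_mono mult_left_mono) (simp_all add: subset_iff)
  finally have "(\<Sum>e\<in>E. prod w' e) - (\<Sum>e\<in>E. prod w e)
      \<le> (\<Sum>v\<in>V. (w' v - w v) * (\<Sum>u\<in>neighbors V E v. l u))"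
    unfolding sum_edge_prod_eq[OF graph] by (simp add: field_simps)
  then have "C * ((\<Sum>e\<in>E. prod w' e) - (\<Sum>e\<in>E. prod w e))
      \<le> C * (\<Sum>v\<in>V. (w' v - w v) * (\<Sum>u\<in>neighbors V E v. l u))"
    using C by (rule mult_left_mono)
  also have "\<dots> = (\<Sum>v\<in>V. (w' v - w v) * Y v)"
    by (simp add: Y_def sum_distrib_left mult_ac)
  also have "\<dots> \<le> (\<Sum>v\<in>V. w' v * (1 + ln (l v / w' v)) - w v * (1 + ln (l v / w v)))"
    by (rule sum_mono[OF gain])
  finally show ?thesis
    unfolding entropy_energy_def w'_def[symmetric] by (simp add: sum_subtractf algebra_simps)
qed

text \<open>By \<open>entropy_energy_le_min\<close> and \<open>entropy_energy_le_max\<close>, the supremum over the open positive orthant is the supremum over a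
  compact box on which the coordinates in \<open>V\<close> are bounded away from zero.\<close>

lemma entropy_energy_has_max:
  assumes C: "C \<ge> 0" and graph: "fin_simple_graph V E" and l: "\<And>v. v \<in> V \<Longrightarrow> l v > 0"
  shows "\<exists>w. is_arg_max (entropy_energy V E C l) (\<lambda>w. \<forall>v\<in>V. w v > 0) w"
proof -
  define d where "d v = l v * exp (- (C * (\<Sum>u\<in>neighbors V E v. l u)))" for v
  \<comment> \<open>Coordinates outside \<open>V\<close> are pinned to zero, since the box lives in all of \<open>'a \<Rightarrow> real\<close>.\<close>
  define lo where "lo v = (if v \<in> V then d v else 0)" for v
  define hi where "hi v = (if v \<in> V then l v else 0)" for v
  define K where "K = {w. \<forall>v. lo v \<le> w v \<and> w v \<le> hi v}"
  let ?F = "entropy_energy V E C l"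
  have d: "0 < d v" "d v \<le> l v" if "v \<in> V" for v
    using l[OF that] C l neighbors_subset[of V E v]
    by (auto simp: d_def intro!: mult_nonneg_nonneg sum_nonneg less_imp_le[OF l])
  have K_pos: "w v > 0" if "w \<in> K" "v \<in> V" for w v
    using that(1) d(1)[OF that(2)] that(2) by (auto simp: K_def lo_def dest!: spec[of _ v])
  have "compact K"
    unfolding K_def by (rule compact_box_functions)
  moreover have "hi \<in> K"
    using d by (auto simp: K_def lo_def hi_def)
  then have "K \<noteq> {}"
    by blast
  moreover have "continuous_on K ?F"
  proof -
    have coord: "continuous_on K (\<lambda>w. w v)" for v
      by (rule continuous_on_product_coordinates[THEN continuous_on_subset]) simp
    show ?thesis
      unfolding entropy_energy_def
      by (intro continuous_intros coord) (use K_pos l in \<open>force+\<close>)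
  qed
  ultimately obtain w where w: "w \<in> K" "\<And>x. x \<in> K \<Longrightarrow> ?F x \<le> ?F w"
    using continuous_attains_sup[of K ?F] by blast
  have "?F x \<le> ?F w" if x: "\<forall>v\<in>V. x v > 0" for x
  proof -
    define x1 where "x1 v = min (l v) (x v)" for v
    define x2 where "x2 v = max (d v) (x1 v)" for v
    \<comment> \<open>Only the values on \<open>V\<close> matter; resetting the others to zero puts the point into the box \<open>K\<close>.\<close>
    define x3 where "x3 v = (if v \<in> V then x2 v else 0)" for v
    have x1: "0 < x1 v \<and> x1 v \<le> l v" if "v \<in> V" for v
      using l x that by (auto simp: x1_def)
    have "?F x \<le> ?F x1"
      unfolding x1_def[abs_def] using x by (intro entropy_energy_le_min C l graph) auto
    also have "\<dots> \<le> ?F x2"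
      unfolding x2_def[abs_def] by (rule entropy_energy_le_max[OF C graph l x1 d_def])
    also have "\<dots> = ?F x3"
    proof -
      have "(\<Prod>v\<in>e. x2 v) = (\<Prod>v\<in>e. x3 v)" if "e \<in> E" for e
        using that graph by (intro prod.cong) (auto simp: x3_def fin_simple_graph_def)
      then show ?thesis
        by (simp add: entropy_energy_def x3_def)
    qed
    also have "\<dots> \<le> ?F w"
      using x1 d by (intro w(2)) (auto simp: K_def lo_def hi_def x3_def x2_def)
    finally show ?thesis .
  qed
  then have "is_arg_max ?F (\<lambda>w. \<forall>v\<in>V. w v > 0) w"
    using K_pos[OF w(1)] by (force simp: is_arg_max_def not_less)
  then show ?thesis
    by blast
qed

section \<open>The explicit bound and the conclusion\<close>

text \<open>Bounding \<open>w u * w v\<close> by \<open>((w u)\<^sup>2 + (w v)\<^sup>2) / 2\<close> decouples the vertices: \<open>v\<close> contributes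
  \<open>w v * (1 + ln (l v / w v)) - k v * (w v)\<^sup>2 / 2\<close> with \<open>k v = C * d v\<close>, where \<open>d v\<close> is the degree.
  This is maximal where \<open>ln (l v / w v) = k v * w v\<close>, that is, where \<open>k v * w v\<close> is the Lambert
  function at \<open>k v * l v\<close>.\<close>

lemma entropy_energy_ge_lambert:
  assumes C: "C > 0" and graph: "fin_simple_graph V E" and l: "\<And>v. v \<in> V \<Longrightarrow> l v > 0"
  shows "\<exists>w. (\<forall>v\<in>V. w v > 0) \<and>
    (\<Sum>v\<in>V. if vdegree V E v = 0 then l v
            else calA (lambert_W (C * real (vdegree V E v) * l v)) / (C * real (vdegree V E v)))
    \<le> entropy_energy V E C l w"
proof -
  define k where "k v = C * real (vdegree V E v)" for v
  define W where "W v = lambert_W (k v * l v)" for v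
  define w where "w v = (if vdegree V E v = 0 then l v else W v / k v)" for v
  have fin: "finite V"
    using graph by (simp add: fin_simple_graph_def)
  have k: "k v > 0" if "vdegree V E v \<noteq> 0" for v
    using that C by (simp add: k_def)
  have W: "W v > 0" "W v * exp (W v) = k v * l v" if "v \<in> V" "vdegree V E v \<noteq> 0" for v
  proof -
    have pos: "k v * l v > 0"
      using k l that by simp
    then show eq: "W v * exp (W v) = k v * l v"
      unfolding W_def by (intro lambert_W(2)) simp
    have "W v \<ge> 0"
      using pos unfolding W_def by (intro lambert_W(1)) simp
    moreover have "W v \<noteq> 0"
      using eq pos by auto
    ultimately show "W v > 0"
      by simp
  qed
  have w: "w v > 0" if "v \<in> V" for v
    using that l k W by (auto simp: w_def)
  have "2 * (\<Sum>e\<in>E. prod w e) = (\<Sum>v\<in>V. \<Sum>u\<in>neighbors V E v. w v * w u)"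
    unfolding sum_edge_prod_eq[OF graph] by (simp add: sum_distrib_left[symmetric])
  also have "\<dots> \<le> (\<Sum>v\<in>V. \<Sum>u\<in>neighbors V E v. (w v)\<^sup>2 / 2 + (w u)\<^sup>2 / 2)"
  proof (intro sum_mono)
    show "w v * w u \<le> (w v)\<^sup>2 / 2 + (w u)\<^sup>2 / 2" for v u
      using sum_squares_bound[of "w v" "w u"] by simp
  qed
  also have "\<dots> = (\<Sum>v\<in>V. real (vdegree V E v) * (w v)\<^sup>2 / 2) + (\<Sum>v\<in>V. 1 * (\<Sum>u\<in>neighbors V E v. (w u)\<^sup>2 / 2))"
    by (simp add: sum.distrib vdegree_def)
  also have "(\<Sum>v\<in>V. 1 * (\<Sum>u\<in>neighbors V E v. (w u)\<^sup>2 / 2)) = (\<Sum>v\<in>V. real (vdegree V E v) * (w v)\<^sup>2 / 2)"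
    by (subst sum_neighbors_swap[OF fin]) (simp add: vdegree_def mult.commute)
  finally have edges: "C * (\<Sum>e\<in>E. prod w e) \<le> (\<Sum>v\<in>V. k v * (w v)\<^sup>2 / 2)"
    using C by (simp add: k_def sum_distrib_left[symmetric] sum_divide_distrib[symmetric] mult.assoc)
  have term_eq: "(if vdegree V E v = 0 then l v else calA (W v) / k v)
      = w v * (1 + ln (l v / w v)) - k v * (w v)\<^sup>2 / 2" if v: "v \<in> V" for v
  proof (cases "vdegree V E v = 0")
    case False
    have kv: "k v > 0" and Wv: "W v > 0" "W v * exp (W v) = k v * l v"
      using k W v False by auto
    have "l v / w v = exp (W v)"
      using kv Wv False by (simp add: w_def field_simps)
    then show ?thesis
      using kv False by (simp add: w_def calA_def field_simps power2_eq_square)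
  next
    case True
    then show ?thesis
      using l[OF v] by (simp add: w_def k_def)
  qed
  have "(\<Sum>v\<in>V. if vdegree V E v = 0 then l v else calA (W v) / k v)
      = (\<Sum>v\<in>V. w v * (1 + ln (l v / w v))) - (\<Sum>v\<in>V. k v * (w v)\<^sup>2 / 2)"
    by (simp add: term_eq sum_subtractf)
  also have "\<dots> \<le> entropy_energy V E C l w"
    using edges by (simp add: entropy_energy_def)
  finally show ?thesis
    using w unfolding W_def k_def by blast
qed

theorem theorem17:
  fixes V :: "'a set" and E :: "'a set set"
    and a L C :: real and lam ell :: "'a \<Rightarrow> real"
  assumes a: "a \<ge> 0"
    and graph: "fin_simple_graph V E"
    and nonempty: "V \<noteq> {}"
    and mad: "\<And>v. v \<in> V \<Longrightarrow> mad (neighbors V E v) (induced_edges E (neighbors V E v)) \<le> a"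
    and lam: "\<And>v. v \<in> V \<Longrightarrow> lam v > 0"
    and ell: "\<And>v. v \<in> V \<Longrightarrow> ell v = ln (1 + lam v)"
    and L: "L = (MAX v\<in>V. ell v)"
    and C: "C = exp (a * L)"
  shows "(\<exists>w. is_arg_max
                (\<lambda>w. (\<Sum>v\<in>V. w v * (1 + ln (ell v / w v))) - C * (\<Sum>e\<in>E. \<Prod>v\<in>e. w v))
                (\<lambda>w. \<forall>v\<in>V. w v > 0) w
            \<and> ln (indep_poly V E lam)
                \<ge> (\<Sum>v\<in>V. w v * (1 + ln (ell v / w v))) - C * (\<Sum>e\<in>E. \<Prod>v\<in>e. w v))
       \<and> ln (indep_poly V E lam)
           \<ge> (\<Sum>v\<in>V. if vdegree V E v = 0 then ell v
                    else calA (lambert_W (C * real (vdegree V E v) * ell v))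
                           / (C * real (vdegree V E v)))"
proof -
  let ?F = "entropy_energy V E C ell"
  have fin: "finite V"
    using graph by (simp add: fin_simple_graph_def)
  have C0: "C > 0"
    by (simp add: C)
  have ell_pos: "ell v > 0" if "v \<in> V" for v
    using ell[OF that] lam[OF that] by (simp add: ln_gt_zero)
  have ell_le: "ell v \<le> L" if "v \<in> V" for v
    using fin that by (simp add: L)
  obtain w where w: "is_arg_max ?F (\<lambda>w. \<forall>v\<in>V. w v > 0) w"
    using entropy_energy_has_max[of C V E ell] C0 graph ell_pos by auto
  then have w_pos: "w v > 0" if "v \<in> V" for v
    using that by (simp add: is_arg_max_def)
  have fp: "ell v = w v * exp (C * (\<Sum>u\<in>neighbors V E v. w u))" if "v \<in> V" for v
    by (rule is_arg_max_entropy_energy_fixed_point[OF graph ell_pos w that])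
  have "?F w = (\<Sum>v\<in>V. w v) + C / 2 * (\<Sum>v\<in>V. w v * (\<Sum>u\<in>neighbors V E v. w u))"
  proof -
    have "w v * (1 + ln (ell v / w v)) = w v + C * (w v * (\<Sum>u\<in>neighbors V E v. w u))" if "v \<in> V" for v
    proof -
      have "ell v / w v = exp (C * (\<Sum>u\<in>neighbors V E v. w u))"
        using fp[OF that] w_pos[OF that] by simp
      then show ?thesis
        by (simp add: algebra_simps)
    qed
    then show ?thesis
      by (simp add: entropy_energy_def sum_edge_prod_eq[OF graph] sum.distrib sum_distrib_left[symmetric])
  qed
  also have "\<dots> \<le> ln (indep_poly V E (\<lambda>v. exp (ell v) - 1))"
    by (rule ln_indep_poly_ge_fixed_point[OF fin a not_self_neighbor[OF graph]
          mad_le_imp_sparse[OF graph neighbors_subset mad] ell_le C w_pos fp])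
  also have "indep_poly V E (\<lambda>v. exp (ell v) - 1) = indep_poly V E lam"
    by (rule indep_poly_cong) (use ell lam in \<open>simp add: add_pos_pos\<close>)
  finally have bound: "?F w \<le> ln (indep_poly V E lam)" .
  obtain x where x: "\<forall>v\<in>V. x v > 0" and
    "(\<Sum>v\<in>V. if vdegree V E v = 0 then ell v
         else calA (lambert_W (C * real (vdegree V E v) * ell v)) / (C * real (vdegree V E v))) \<le> ?F x"
    using entropy_energy_ge_lambert[of C V E ell] C0 graph ell_pos by auto
  moreover have "?F x \<le> ?F w"
    by (rule is_arg_max_ge[OF w]) (rule x)
  ultimately show ?thesis
    using w bound unfolding entropy_energy_def[abs_def] by (blast intro: order_trans)
qed

end
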